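(* Let $\beta\in\mathbb{C}$ be an algebraic integer with $|\beta|>1$, let $\mathcal{A}\subset\mathbb{Z}[\beta]$ be a finite alphabet with $0\in\mathcal{A}$ and $1\in\mathcal{A}[\beta]$, and let $\mathcal{B}\subset\mathbb{Z}[\beta]$ be an input alphabet with $\mathcal{A}\subsetneq\mathcal{B}\subset\mathcal{A}+\mathcal{A}$. If the Extending Window Method with the rewriting rule $x-\beta$ converges for the numeration system $(\beta,\mathcal{A})$ (with input alphabet $\mathcal{B}$), then $\beta$ is expanding, i.e. every algebraic conjugate of $\beta$ (including $\beta$ itself) has modulus strictly greater than $1$.
   Context: $\mathcal{A}[\beta]=\{\sum_{i=0}^N a_i\beta^i: a_i\in\mathcal{A}, N\in\mathbb{N}\}$ and $\mathbb{Z}[\beta]$ is defined analogously with integer coefficients. The Extending Window Method (EWM) with rewriting rule $x-\beta$ consists of two phases. Phase 1: set $\mathcal{Q}_0=\{0\}$; given $\mathcal{Q}_k$, for each $x\in\mathcal{B}+\mathcal{Q}_k$ let $C_x=\{(x-a)/\beta: a\in\mathcal{A},\ x-a\in\beta\mathbb{Z}[\beta]\}$, and choose $\mathcal{Q}_{k+1}$ with $\mathcal{Q}_k\subset\mathcal{Q}_{k+1}\subset\mathcal{Q}_k\cup\bigcup_x C_x$ such that $C_x\cap\mathcal{Q}_{k+1}\neq\emptyset$ for every $x\in\mathcal{B}+\mathcal{Q}_k$; stop when $\mathcal{Q}_{k+1}=\mathcal{Q}_k$ and set $\mathcal{Q}=\mathcal{Q}_k$ (so $0\in\mathcal{Q}$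 and $\mathcal{B}+\mathcal{Q}\subset\mathcal{A}+\beta\mathcal{Q}$). Phase 2: for every $n\ge1$ and $(x_1,\dots,x_n)\in\mathcal{B}^n$ sets $\mathcal{Q}_{[x_1,\dots,x_n]}\subset\mathcal{Q}$ are chosen with $x_1+\mathcal{Q}\subset\mathcal{A}+\beta\mathcal{Q}_{[x_1]}$ and, for $n\ge2$, $\mathcal{Q}_{[x_1,\dots,x_n]}\subset\mathcal{Q}_{[x_1,\dots,x_{n-1}]}$ with $x_1+\mathcal{Q}_{[x_2,\dots,x_n]}\subset\mathcal{A}+\beta\mathcal{Q}_{[x_1,\dots,x_n]}$; Phase 2 stops at the first $r$ such that $\#\mathcal{Q}_{[x_1,\dots,x_r]}=1$ for all $(x_1,\dots,x_r)\in\mathcal{B}^r$, and the weight function $q(x_1,\dots,x_r)$ is the unique element of that set. The EWM converges if both phases stop after finitely many steps; it then yields the digit set conversion $z_j=w_j+q(w_{j-1},\dots,w_{j-r})-\beta\,q(w_j,\dots,w_{j-r+1})\in\mathcal{A}$ from $\mathcal{B}$ to $\mathcal{A}$ computable by a local function with zero anticipation. *)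

theory Defs
  imports "HOL-Analysis.Analysis" "HOL-Computational_Algebra.Computational_Algebra"
begin

text \<open>
  Sums of sets \<open>A + B\<close>, translates \<open>x +o B\<close> and dilates \<open>x *o B\<close> are those of
  \<^theory>\<open>HOL-Library.Set_Algebras\<close>.
\<close>

definition radix_set :: "complex set \<Rightarrow> complex \<Rightarrow> complex set"
  where "radix_set D \<beta> = {(\<Sum>i\<le>N. a i * \<beta> ^ i) | a N. \<forall>i\<le>N. a i \<in> D}"

abbreviation int_adjoin :: "complex \<Rightarrow> complex set"
  where "int_adjoin \<beta> \<equiv> radix_set \<int> \<beta>"

definition is_min_poly :: "rat poly \<Rightarrow> complex \<Rightarrow> bool"
  where "is_min_poly p x \<longleftrightarrow>
    lead_coeff p = 1 \<and> poly (map_poly of_rat p) x = 0 \<and>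
    (\<forall>q. q \<noteq> 0 \<longrightarrow> poly (map_poly of_rat q) x = 0 \<longrightarrow> degree p \<le> degree q)"

text \<open>
  The set of conjugates of \<open>x\<close> is only meaningful for algebraic \<open>x\<close>; it is empty otherwise.
\<close>

definition alg_conjugates :: "complex \<Rightarrow> complex set"
  where "alg_conjugates x = {y. \<exists>p. is_min_poly p x \<and> poly (map_poly of_rat p) y = 0}"

definition expanding :: "complex \<Rightarrow> bool"
  where "expanding x \<longleftrightarrow> (\<forall>y\<in>alg_conjugates x. norm y > 1)"

lemma is_min_poly_exists:
  assumes "algebraic x"
  shows "\<exists>p. is_min_poly p x"
proof -
  let ?P = "\<lambda>q::rat poly. q \<noteq> 0 \<and> poly (map_poly of_rat q) x = 0"
  obtain p where p: "\<And>i. coeff p i \<in> \<int>" "p \<noteq> 0" "poly p x = 0"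
    using assms by (auto simp: algebraic_def)
  have "\<exists>n::int. coeff p i = of_int n" for i
    using p(1)[of i] by (auto elim: Ints_cases)
  then obtain f :: "nat \<Rightarrow> int" where f: "\<And>i. coeff p i = of_int (f i)" by metis
  have f0: "f i = 0 \<longleftrightarrow> coeff p i = 0" for i using f[of i] by simp
  have fin: "\<forall>\<^sub>\<infinity>i. of_int (f i) = (0::rat)"
    using MOST_coeff_eq_0[of p] by (simp add: f0)
  define r where "r = (Abs_poly (\<lambda>i. of_int (f i)) :: rat poly)"
  have cr: "coeff r i = of_int (f i)" for i
    unfolding r_def using fin by (subst Abs_poly_inverse) auto
  have eq: "map_poly of_rat r = p"
    by (rule poly_eqI) (simp add: coeff_map_poly cr f)
  have "?P r" using p eq by auto
  then obtain q where q: "?P q" and min: "\<And>s. ?P s \<Longrightarrow> degree q \<le> degree s"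
    using ex_has_least_nat[of ?P r degree] by blast
  define m where "m = smult (inverse (lead_coeff q)) q"
  have map_m: "map_poly of_rat m = smult (of_rat (inverse (lead_coeff q))) (map_poly of_rat q :: complex poly)"
    unfolding m_def by (rule poly_eqI) (simp add: coeff_map_poly of_rat_mult)
  have "is_min_poly m x"
    unfolding is_min_poly_def
  proof (intro conjI allI impI)
    show "lead_coeff m = 1" using q by (simp add: m_def)
    show "poly (map_poly of_rat m) x = 0" using q by (simp add: map_m)
    show "degree m \<le> degree s" if "s \<noteq> 0" "poly (map_poly of_rat s) x = 0" for s
      using min[of s] that q by (simp add: m_def)
  qed
  then show ?thesis ..
qed

lemma self_in_alg_conjugates: "algebraic x \<Longrightarrow> x \<in> alg_conjugates x"
  using is_min_poly_exists[of x] unfolding alg_conjugates_def is_min_poly_def by blast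

definition ewm_candidates :: "complex \<Rightarrow> complex set \<Rightarrow> complex \<Rightarrow> complex set"
  where "ewm_candidates \<beta> A x = {(x - a) / \<beta> | a. a \<in> A \<and> x - a \<in> \<beta> *o int_adjoin \<beta>}"

definition phase1_step :: "complex \<Rightarrow> complex set \<Rightarrow> complex set \<Rightarrow> complex set \<Rightarrow> complex set \<Rightarrow> bool"
  where "phase1_step \<beta> A B Q Q' \<longleftrightarrow>
    Q \<subseteq> Q' \<and>
    Q' \<subseteq> Q \<union> (\<Union>x\<in>B + Q. ewm_candidates \<beta> A x) \<and>
    (\<forall>x\<in>B + Q. ewm_candidates \<beta> A x \<inter> Q' \<noteq> {})"

text \<open>
  The Extending Window Method with rewriting rule \<open>x - \<beta>\<close> is nondeterministic: every
  step chooses among the admissible sets. A set is a result of Phase 1 if some sequence of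
  admissible choices stops with it; only the part of the sequence up to the stopping index is
  constrained.
\<close>

definition phase1_result :: "complex \<Rightarrow> complex set \<Rightarrow> complex set \<Rightarrow> complex set \<Rightarrow> bool"
  where "phase1_result \<beta> A B Q \<longleftrightarrow>
    (\<exists>(Qs :: nat \<Rightarrow> complex set) K.
      Qs 0 = {0} \<and>
      (\<forall>k\<le>K. phase1_step \<beta> A B (Qs k) (Qs (Suc k))) \<and>
      (\<forall>k<K. Qs (Suc k) \<noteq> Qs k) \<and>
      Qs (Suc K) = Qs K \<and>
      Q = Qs K)"

text \<open>
  \<open>R [x\<^sub>1, \<dots>, x\<^sub>n]\<close> is the set indexed by the window \<open>(x\<^sub>1, \<dots>, x\<^sub>n) \<in> B\<^sup>n\<close>; the
  conditions concern the windows of length at most \<open>r\<close>.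
\<close>

definition phase2_admissible ::
    "complex \<Rightarrow> complex set \<Rightarrow> complex set \<Rightarrow> complex set \<Rightarrow> nat \<Rightarrow> (complex list \<Rightarrow> complex set) \<Rightarrow> bool"
  where "phase2_admissible \<beta> A B Q r R \<longleftrightarrow>
    (\<forall>xs\<in>lists B. 1 \<le> length xs \<and> length xs \<le> r \<longrightarrow> R xs \<subseteq> Q) \<and>
    (\<forall>x\<in>B. x +o Q \<subseteq> A + \<beta> *o R [x]) \<and>
    (\<forall>xs\<in>lists B. 2 \<le> length xs \<and> length xs \<le> r \<longrightarrow>
      R xs \<subseteq> R (butlast xs) \<and> hd xs +o R (tl xs) \<subseteq> A + \<beta> *o R xs)"

definition phase2_stops :: "complex set \<Rightarrow> nat \<Rightarrow> (complex list \<Rightarrow> complex set) \<Rightarrow> bool"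
  where "phase2_stops B r R \<longleftrightarrow>
    r \<ge> 1 \<and>
    (\<forall>xs\<in>lists B. length xs = r \<longrightarrow> card (R xs) = 1) \<and>
    (\<forall>n. 1 \<le> n \<and> n < r \<longrightarrow> (\<exists>xs\<in>lists B. length xs = n \<and> card (R xs) \<noteq> 1))"

definition ewm_converges :: "complex \<Rightarrow> complex set \<Rightarrow> complex set \<Rightarrow> bool"
  where "ewm_converges \<beta> A B \<longleftrightarrow>
    (\<exists>Q r R. phase1_result \<beta> A B Q \<and> phase2_admissible \<beta> A B Q r R \<and> phase2_stops B r R)"

lemma phase1_result_covers:
  assumes "\<beta> \<noteq> 0" "phase1_result \<beta> A B Q"
  shows "B + Q \<subseteq> A + \<beta> *o Q"
proof
  fix x assume x: "x \<in> B + Q"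
  obtain q where "q \<in> ewm_candidates \<beta> A x" "q \<in> Q"
    using assms(2) x unfolding phase1_result_def phase1_step_def by (metis disjoint_iff order_refl)
  then obtain a where "a \<in> A" "q = (x - a) / \<beta>"
    by (auto simp: ewm_candidates_def)
  with assms(1) have "x = a + \<beta> * q" by simp
  with \<open>a \<in> A\<close> \<open>q \<in> Q\<close> show "x \<in> A + \<beta> *o Q"
    by (auto intro!: set_plus_intro simp: elt_set_times_def)
qed

end

theory Submission
  imports Defs
begin

text \<open>
  Let \<open>\<gamma>\<close> be a conjugate of \<open>\<beta>\<close> and \<open>\<sigma>\<close> the field isomorphism \<open>\<rat>(\<beta>) \<rightarrow> \<rat>(\<gamma>)\<close>.

  Suppose \<open>\<bar>\<gamma>\<bar> < 1\<close>. Fix a window \<open>s\<close> of past digits. The conversion has zero anticipation, so it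
  acts on infinite strings \<open>w\<^sub>0, w\<^sub>1, \<dots>\<close> with past \<open>s\<close>, and telescoping gives
  \<open>\<Sum> \<sigma>(z\<^sub>j) \<gamma>\<^sup>j = \<sigma>(q(s)) + \<Sum> \<sigma>(w\<^sub>j) \<gamma>\<^sup>j\<close>. The output is a string over \<open>A \<subseteq> B\<close>, so the
  conversion can be repeated with the same past; after \<open>n\<close> rounds the sum has moved by
  \<open>n \<sigma>(q(s))\<close>, but sums of strings over \<open>A\<close> are bounded. Hence \<open>q = 0\<close> identically, the
  conversion is the identity, and \<open>B \<subseteq> A\<close>, a contradiction.

  Suppose \<open>\<bar>\<gamma>\<bar> = 1\<close>. Then \<open>1/\<gamma>\<close> is the complex conjugate of \<open>\<gamma>\<close> and so is also a conjugate of
  \<open>\<beta>\<close>. The minimal polynomial is therefore self-reciprocal up to a factor, and \<open>1/\<beta>\<close> is a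
  conjugate of modulus less than \<open>1\<close>, which is the first case.
\<close>

section \<open>Conjugates and the field isomorphism\<close>

abbreviation rat_eval :: "rat poly \<Rightarrow> complex \<Rightarrow> complex"
  where "rat_eval f \<equiv> poly (map_poly of_rat f)"

lemma map_poly_of_rat_add:
  "map_poly of_rat (f + g) = (map_poly of_rat f + map_poly of_rat g :: 'a::field_char_0 poly)"
  by (rule poly_eqI) (simp add: coeff_map_poly of_rat_add)

lemma map_poly_of_rat_diff:
  "map_poly of_rat (f - g) = (map_poly of_rat f - map_poly of_rat g :: 'a::field_char_0 poly)"
  by (rule poly_eqI) (simp add: coeff_map_poly of_rat_diff)

lemma map_poly_of_rat_mult:
  "map_poly of_rat (f * g) = (map_poly of_rat f * map_poly of_rat g :: 'a::field_char_0 poly)"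
  by (rule poly_eqI) (simp add: coeff_map_poly coeff_mult of_rat_sum of_rat_mult)

lemma map_poly_of_rat_reflect:
  "map_poly of_rat (reflect_poly f) = (reflect_poly (map_poly of_rat f) :: 'a::field_char_0 poly)"
proof -
  have "degree (map_poly of_rat f :: 'a poly) = degree f"
    by (rule degree_map_poly) simp
  then show ?thesis
    by (intro poly_eqI) (simp add: coeff_map_poly coeff_reflect_poly)
qed

lemma rat_eval_cnj: "rat_eval f (cnj x) = cnj (rat_eval f x)"
proof -
  have "cnj (of_rat r) = of_rat r" for r
    by (cases r) (simp add: of_rat_rat)
  then show ?thesis
    by (simp add: poly_altdef coeff_map_poly)
qed

lemma is_min_poly_dvd:
  assumes "is_min_poly m x" "rat_eval f x = 0"
  shows "m dvd f"
proof (rule ccontr)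
  assume "\<not> m dvd f"
  then have nz: "f mod m \<noteq> 0" by (simp add: dvd_eq_mod_eq_0)
  have m: "m \<noteq> 0" "rat_eval m x = 0" using assms(1) by (auto simp: is_min_poly_def)
  have "rat_eval (f mod m) x = 0"
    using assms(2) m(2)
    by (simp add: minus_div_mult_eq_mod[symmetric] map_poly_of_rat_diff map_poly_of_rat_mult)
  then have "degree m \<le> degree (f mod m)"
    using assms(1) nz by (auto simp: is_min_poly_def)
  with degree_mod_less[OF m(1), of f] nz show False by simp
qed

lemma algebraic_rat_root:
  assumes "f \<noteq> 0" "rat_eval f x = 0"
  shows "algebraic x"
  unfolding algebraic_altdef
proof (intro exI conjI allI)
  show "map_poly of_rat f \<noteq> (0 :: complex poly)"
    using assms(1) by (simp add: map_poly_eq_0_iff)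
qed (use assms in \<open>auto simp: coeff_map_poly\<close>)

text \<open>Irreducibility in disguise: the minimal polynomial \<open>n\<close> of \<open>y\<close>
  divides \<open>m\<close>, and the cofactor \<open>k\<close> cannot vanish at \<open>x\<close>
  because its degree is below that of \<open>m\<close>. So \<open>n\<close> vanishes at
  \<open>x\<close>, and minimality forces \<open>k = 1\<close>. Symmetry of conjugacy rests on
  this.\<close>

lemma is_min_poly_root:
  assumes m: "is_min_poly m x" and root: "rat_eval m y = 0"
  shows "is_min_poly m y"
proof -
  have lc: "lead_coeff m = 1" and mx: "rat_eval m x = 0"
    and min: "\<And>f. f \<noteq> 0 \<Longrightarrow> rat_eval f x = 0 \<Longrightarrow> degree m \<le> degree f"
    using m by (auto simp: is_min_poly_def)
  have m0: "m \<noteq> 0" using lc by auto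
  obtain n where n: "is_min_poly n y"
    using is_min_poly_exists algebraic_rat_root[OF m0 root] by blast
  then have lcn: "lead_coeff n = 1" and ny: "rat_eval n y = 0" by (auto simp: is_min_poly_def)
  obtain k where k: "m = n * k" using is_min_poly_dvd[OF n root] by (auto elim: dvdE)
  have nz: "n \<noteq> 0" "k \<noteq> 0" using k m0 by auto
  have deg: "degree m = degree n + degree k" using k nz by (simp add: degree_mult_eq)
  have "degree n \<noteq> 0"
  proof
    assume "degree n = 0"
    then have "n = [:1:]" using lcn by (metis degree_0_id)
    then show False using ny by (simp add: map_poly_pCons)
  qed
  then have "rat_eval k x \<noteq> 0" using min[OF nz(2)] deg by auto
  then have "rat_eval n x = 0" using mx k by (simp add: map_poly_of_rat_mult)
  then have "degree m \<le> degree n" using min nz by blast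
  then have "degree k = 0" using deg by simp
  moreover have "lead_coeff k = 1" using lc lcn k by (simp add: lead_coeff_mult)
  ultimately have "k = 1" by (metis degree_0_id one_pCons)
  then show ?thesis using k n by simp
qed

lemma alg_conjugates_sym: "y \<in> alg_conjugates x \<Longrightarrow> x \<in> alg_conjugates y"
  unfolding alg_conjugates_def using is_min_poly_root by (auto simp: is_min_poly_def)

lemma alg_conjugates_rat_eval:
  assumes "y \<in> alg_conjugates x" "rat_eval f x = 0"
  shows "rat_eval f y = 0"
proof -
  obtain m where m: "is_min_poly m x" "rat_eval m y = 0"
    using assms(1) by (auto simp: alg_conjugates_def)
  obtain k where "f = m * k" using is_min_poly_dvd[OF m(1) assms(2)] by (auto elim: dvdE)
  then show ?thesis using m(2) by (simp add: map_poly_of_rat_mult)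
qed

lemma inverse_in_alg_conjugates:
  assumes y: "y \<in> alg_conjugates x" and "norm y = 1" and "x \<noteq> 0"
  shows "inverse x \<in> alg_conjugates x"
proof -
  obtain m where m: "is_min_poly m x" "rat_eval m y = 0"
    using y by (auto simp: alg_conjugates_def)
  have "y * cnj y = 1" using assms(2) by (simp add: complex_norm_square[symmetric])
  then have "inverse y = cnj y" by (metis inverse_unique)
  moreover have "y \<noteq> 0" using assms(2) by auto
  ultimately have "rat_eval (reflect_poly m) y = 0"
    using m(2) by (simp add: map_poly_of_rat_reflect poly_reflect_poly_nz rat_eval_cnj)
  \<comment> \<open>A rational polynomial vanishing at \<open>y\<close> vanishes at its conjugate
    \<open>x\<close> too; this carries the reciprocal symmetry from the unit circle over to
    \<open>x\<close>.\<close>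
  then have "rat_eval (reflect_poly m) x = 0"
    using alg_conjugates_rat_eval alg_conjugates_sym[OF y] by blast
  then have "rat_eval m (inverse x) = 0"
    using \<open>x \<noteq> 0\<close> by (simp add: map_poly_of_rat_reflect poly_reflect_poly_nz)
  then show ?thesis using m(1) by (auto simp: alg_conjugates_def)
qed

text \<open>Rational polynomials that agree at \<open>x\<close> agree at \<open>y\<close>, so the
  choice made by \<open>SOME\<close> does not matter. The single equation encodes additivity,
  multiplicativity and the passage from \<open>x\<close> to \<open>y\<close>; elsewhere \<sigma> is
  arbitrary.\<close>

lemma alg_conjugates_hom:
  assumes "y \<in> alg_conjugates x"
  obtains \<sigma> where "\<And>f. \<sigma> (rat_eval f x) = rat_eval f y"
proof
  fix f
  let ?g = "SOME g. rat_eval g x = rat_eval f x"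
  have "rat_eval ?g x = rat_eval f x" by (rule someI) (rule refl)
  then have "rat_eval (?g - f) y = 0"
    by (intro alg_conjugates_rat_eval[OF assms]) (simp add: map_poly_of_rat_diff)
  then show "(\<lambda>u. rat_eval (SOME g. rat_eval g x = u) y) (rat_eval f x) = rat_eval f y"
    by (simp add: map_poly_of_rat_diff)
qed

lemma int_adjoin_subset_rat_eval: "int_adjoin x \<subseteq> range (\<lambda>f. rat_eval f x)"
proof
  fix u assume "u \<in> int_adjoin x"
  then obtain a N where u: "u = (\<Sum>i\<le>N. a i * x ^ i)" and "\<And>i. i \<le> N \<Longrightarrow> a i \<in> \<int>"
    by (auto simp: radix_set_def)
  then have "\<exists>n::int. a i = of_int n" if "i \<le> N" for i using that by (auto elim: Ints_cases)
  then obtain c :: "nat \<Rightarrow> int" where c: "\<And>i. i \<le> N \<Longrightarrow> a i = of_int (c i)" by metis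
  have "rat_eval (\<Sum>i\<le>N. monom (of_int (c i)) i) x = (\<Sum>i\<le>N. of_int (c i) * x ^ i)"
    by (induction N) (simp_all add: map_poly_of_rat_add map_poly_monom poly_monom)
  also have "\<dots> = u" unfolding u using c by (intro sum.cong) auto
  finally show "u \<in> range (\<lambda>f. rat_eval f x)" by (intro range_eqI) (rule sym)
qed

section \<open>Transducers with zero anticipation\<close>

text \<open>\<open>t s\<close> is the carry held in state \<open>s\<close> and \<open>d\<close> the
  value of a digit. The carries telescope along the run, so one pass adds exactly the initial
  carry.\<close>

lemma transducer_round:
  fixes \<gamma> :: complex and t :: "'s \<Rightarrow> complex" and d :: "'a \<Rightarrow> complex"
  assumes "norm \<gamma> < 1" "finite A" "finite (t ` S)"
    and closed: "\<And>x s. x \<in> A \<Longrightarrow> s \<in> S \<Longrightarrow> step x s \<in> S"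
    and out: "\<And>x s. x \<in> A \<Longrightarrow> s \<in> S \<Longrightarrow> \<exists>a\<in>A. d a = d x + t s - \<gamma> * t (step x s)"
    and "s0 \<in> S" and w: "\<And>j. w j \<in> A" and w_sums: "(\<lambda>j. d (w j) * \<gamma> ^ j) sums W"
  shows "\<exists>z. (\<forall>j::nat. z j \<in> A) \<and> (\<lambda>j. d (z j) * \<gamma> ^ j) sums (W + t s0)"
proof -
  define s where "s = rec_nat s0 (\<lambda>j. step (w j))"
  have s_0: "s 0 = s0" and s_Suc: "\<And>j. s (Suc j) = step (w j) (s j)" by (simp_all add: s_def)
  have sS: "s j \<in> S" for j by (induction j) (auto simp: s_0 s_Suc \<open>s0 \<in> S\<close> closed w)
  have "\<exists>a\<in>A. d a = d (w j) + t (s j) - \<gamma> * t (s (Suc j))" for j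
    using out[OF w sS] by (simp add: s_Suc)
  then obtain z where z: "\<And>j. z j \<in> A"
    and dz: "\<And>j. d (z j) = d (w j) + t (s j) - \<gamma> * t (s (Suc j))" by metis
  obtain C where C: "\<And>u. u \<in> S \<Longrightarrow> norm (t u) \<le> C"
    using finite_imp_bounded[OF assms(3)] by (auto simp: bounded_iff)
  \<comment> \<open>The carries take finitely many values, so the boundary term of the telescoping
    sum dies out inside the unit disc.\<close>
  have "(\<lambda>j. t (s j) * \<gamma> ^ j) \<longlonglongrightarrow> 0"
  proof (rule Lim_null_comparison)
    show "\<forall>\<^sub>F j in sequentially. norm (t (s j) * \<gamma> ^ j) \<le> C * norm \<gamma> ^ j"
      using C[OF sS] by (intro always_eventually allI) (simp add: norm_mult norm_power mult_right_mono)
    show "(\<lambda>j. C * norm \<gamma> ^ j) \<longlonglongrightarrow> 0"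
      by (intro tendsto_mult_right_zero LIMSEQ_power_zero) (use assms(1) in simp)
  qed
  then have "(\<lambda>j. t (s j) * \<gamma> ^ j - t (s (Suc j)) * \<gamma> ^ Suc j) sums (t s0)"
    using telescope_sums'[of "\<lambda>j. t (s j) * \<gamma> ^ j" 0] by (simp add: s_0)
  from sums_add[OF w_sums this] have "(\<lambda>j. d (z j) * \<gamma> ^ j) sums (W + t s0)"
    by (simp add: dz algebra_simps)
  with z show ?thesis by blast
qed

lemma transducer_carry_zero:
  fixes \<gamma> :: complex and t :: "'s \<Rightarrow> complex" and d :: "'a \<Rightarrow> complex"
  assumes \<gamma>: "norm \<gamma> < 1" and A: "finite A" "A \<noteq> {}" and "finite (t ` S)"
    and "\<And>x s. x \<in> A \<Longrightarrow> s \<in> S \<Longrightarrow> step x s \<in> S"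
    and "\<And>x s. x \<in> A \<Longrightarrow> s \<in> S \<Longrightarrow> \<exists>a\<in>A. d a = d x + t s - \<gamma> * t (step x s)"
    and "s0 \<in> S"
  shows "t s0 = 0"
proof (rule ccontr)
  assume nz: "t s0 \<noteq> 0"
  obtain C where C: "\<And>a. a \<in> A \<Longrightarrow> norm (d a) \<le> C"
    using finite_imp_bounded[of "d ` A"] A(1) by (auto simp: bounded_iff)
  have geo: "(\<lambda>j. C * norm \<gamma> ^ j) sums (C * (1 / (1 - norm \<gamma>)))"
    by (intro sums_mult geometric_sums) (use \<gamma> in simp)
  have le: "norm (d (w j) * \<gamma> ^ j) \<le> C * norm \<gamma> ^ j" if "\<And>j. w j \<in> A" for w j
    using C[OF that] by (simp add: norm_mult norm_power mult_right_mono)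
  obtain a where a: "a \<in> A" using A(2) by blast
  define W where "W = (\<Sum>j. d a * \<gamma> ^ j)"
  have "summable (\<lambda>j. d a * \<gamma> ^ j)"
    by (intro summable_mult summable_geometric \<gamma>)
  then have base: "(\<lambda>j. d a * \<gamma> ^ j) sums W" unfolding W_def by (rule summable_sums)
  \<comment> \<open>Each round restarts in \<open>s0\<close> and reads the previous output, so it
    adds \<open>t s0\<close> once more.\<close>
  have rounds: "\<exists>z. (\<forall>j::nat. z j \<in> A) \<and> (\<lambda>j. d (z j) * \<gamma> ^ j) sums (W + of_nat n * t s0)" for n
  proof (induction n)
    case 0
    show ?case using a base by (intro exI[of _ "\<lambda>_. a"]) simp
  next
    case (Suc n)
    then obtain z where "\<And>j. z j \<in> A" "(\<lambda>j. d (z j) * \<gamma> ^ j) sums (W + of_nat n * t s0)"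
      by blast
    from transducer_round[of \<gamma> A t S step d s0 z, OF \<gamma> A(1) assms(4-7) this]
    show ?case by (simp add: algebra_simps)
  qed
  have bound: "norm (W + of_nat n * t s0) \<le> C * (1 / (1 - norm \<gamma>))" for n
  proof -
    obtain z where z: "\<And>j. z j \<in> A" "(\<lambda>j. d (z j) * \<gamma> ^ j) sums (W + of_nat n * t s0)"
      using rounds[of n] by blast
    show ?thesis by (rule norm_sums_le[OF z(2) geo]) (rule le[OF z(1)])
  qed
  \<comment> \<open>Enough rounds for the drift to exceed the geometric bound on strings over
    \<open>A\<close> plus the size of the starting value.\<close>
  obtain n where n: "real n * norm (t s0) > C * (1 / (1 - norm \<gamma>)) + norm W"
    using reals_Archimedean3[of "norm (t s0)"] nz by (metis zero_less_norm_iff)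
  have "real n * norm (t s0) = norm ((W + of_nat n * t s0) - W)" by (simp add: norm_mult)
  also have "\<dots> \<le> C * (1 / (1 - norm \<gamma>)) + norm W"
    using norm_triangle_ineq4[of "W + of_nat n * t s0" W] bound[of n] by linarith
  finally show False using n by simp
qed

section \<open>The weight function of the Extending Window Method\<close>

text \<open>Ensures that weights lie where the field isomorphism is determined. The reason is the
  divisibility condition in \<open>ewm_candidates\<close>.\<close>

lemma phase1_result_int_adjoin:
  assumes "\<beta> \<noteq> 0" "phase1_result \<beta> A B Q"
  shows "Q \<subseteq> int_adjoin \<beta>"
proof -
  obtain Qs K where Qs0: "Qs 0 = {0}" and step: "\<And>k. k \<le> K \<Longrightarrow> phase1_step \<beta> A B (Qs k) (Qs (Suc k))"
    and "Q = Qs K" using assms(2) by (auto simp: phase1_result_def)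
  have cand: "ewm_candidates \<beta> A x \<subseteq> int_adjoin \<beta>" for x
    using assms(1) by (auto simp: ewm_candidates_def elt_set_times_def)
  have "Qs k \<subseteq> int_adjoin \<beta>" if "k \<le> K" for k
    using that
  proof (induction k)
    case 0
    have "0 \<in> int_adjoin \<beta>"
      unfolding radix_set_def mem_Collect_eq
      by (rule exI[of _ "\<lambda>_. 0"]) simp
    then show ?case by (simp add: Qs0)
  next
    case (Suc k)
    then have "Qs k \<subseteq> int_adjoin \<beta>" by simp
    moreover have "Qs (Suc k) \<subseteq> Qs k \<union> (\<Union>x\<in>B + Qs k. ewm_candidates \<beta> A x)"
      using step[of k] Suc.prems unfolding phase1_step_def by simp
    ultimately show ?case using cand by blast
  qed
  then show ?thesis using \<open>Q = Qs K\<close> by simp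
qed

text \<open>
  Windows are listed with the most recent digit first, so \<open>butlast (x # ys)\<close> is the window
  after reading \<open>x\<close> in the window \<open>ys\<close>.
\<close>

lemma ewm_weight_function:
  assumes "\<beta> \<noteq> 0" "ewm_converges \<beta> A B"
  obtains r q where
    "\<And>ys. ys \<in> lists B \<Longrightarrow> length ys = r \<Longrightarrow> q ys \<in> int_adjoin \<beta>"
    "\<And>x ys. x \<in> B \<Longrightarrow> ys \<in> lists B \<Longrightarrow> length ys = r \<Longrightarrow>
       \<exists>a\<in>A. x + q ys = a + \<beta> * q (butlast (x # ys))"
proof -
  obtain Q r R where p1: "phase1_result \<beta> A B Q" and p2: "phase2_admissible \<beta> A B Q r R"
    and p3: "phase2_stops B r R" using assms(2) by (auto simp: ewm_converges_def)
  have r: "r \<ge> 1" and card: "\<And>ys. ys \<in> lists B \<Longrightarrow> length ys = r \<Longrightarrow> card (R ys) = 1"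
    using p3 by (auto simp: phase2_stops_def)
  define q where "q ys = the_elem (R ys)" for ys
  have Rq: "R ys = {q ys}" if "ys \<in> lists B" "length ys = r" for ys
  proof -
    have "card (R ys) = 1" using card that by blast
    then obtain u where "R ys = {u}" by (rule card_1_singletonE)
    then show ?thesis by (simp add: q_def)
  qed
  have RQ: "R ys \<subseteq> Q" if "ys \<in> lists B" "length ys = r" for ys
    using p2 that r by (auto simp: phase2_admissible_def)
  show thesis
  proof
    fix ys assume ys: "ys \<in> lists B" "length ys = r"
    then show "q ys \<in> int_adjoin \<beta>"
      using RQ[OF ys] Rq[OF ys] phase1_result_int_adjoin[OF assms(1) p1] by blast
    fix x assume x: "x \<in> B"
    let ?zs = "butlast (x # ys)"
    have zs: "?zs \<in> lists B" "length ?zs = r"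
      using x ys by (auto dest: in_set_butlastD)
    have ne: "ys \<noteq> []" using ys r by auto
    then have tl: "?zs = x # butlast ys" by simp
    \<comment> \<open>Windows of length 1 have their own rule, which starts from all of
      \<open>Q\<close>; longer ones start from the set of their tail.\<close>
    have "x + q ys \<in> A + \<beta> *o R ?zs"
    proof (cases "r = 1")
      case True
      then have "butlast ys = []" using ys(2) by (cases ys) auto
      moreover have "q ys \<in> Q" using RQ[OF ys] Rq[OF ys] by blast
      moreover have "x +o Q \<subseteq> A + \<beta> *o R [x]" using p2 x by (simp add: phase2_admissible_def)
      ultimately show ?thesis using tl by (auto simp: elt_set_plus_def)
    next
      case False
      with r have r2: "2 \<le> r" by simp
      have step: "R us \<subseteq> R (butlast us) \<and> hd us +o R (tl us) \<subseteq> A + \<beta> *o R us"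
        if "us \<in> lists B" "length us = r" for us
        using p2 that r2 unfolding phase2_admissible_def by simp
      \<comment> \<open>\<open>butlast ys\<close> is the tail of \<open>?zs\<close>, so by nesting
        \<open>q ys\<close> lies in the set from which the rule for \<open>?zs\<close>
        starts.\<close>
      have "R ys \<subseteq> R (butlast ys)" and "hd ?zs +o R (tl ?zs) \<subseteq> A + \<beta> *o R ?zs"
        using step[OF ys] step[OF zs] by simp_all
      then show ?thesis using Rq[OF ys] tl by (auto simp: elt_set_plus_def)
    qed
    then show "\<exists>a\<in>A. x + q ys = a + \<beta> * q ?zs"
      using Rq[OF zs] by (auto simp: elt_set_times_def elim!: set_plus_elim)
  qed
qed

section \<open>Excluding conjugates inside the unit disc, then on the unit circle\<close>

lemma ewm_converges_conjugate_norm_ge_1: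
  assumes "\<beta> \<noteq> 0" "finite A" "0 \<in> A" "finite B" "A \<subset> B" "B \<subseteq> int_adjoin \<beta>"
    and conv: "ewm_converges \<beta> A B" and \<gamma>: "\<gamma> \<in> alg_conjugates \<beta>"
  shows "norm \<gamma> \<ge> 1"
proof (rule ccontr)
  assume "\<not> norm \<gamma> \<ge> 1"
  then have small: "norm \<gamma> < 1" by simp
  obtain r q where q: "\<And>ys. ys \<in> lists B \<Longrightarrow> length ys = r \<Longrightarrow> q ys \<in> int_adjoin \<beta>"
    and rule: "\<And>x ys. x \<in> B \<Longrightarrow> ys \<in> lists B \<Longrightarrow> length ys = r \<Longrightarrow>
       \<exists>a\<in>A. x + q ys = a + \<beta> * q (butlast (x # ys))"
    using ewm_weight_function[OF assms(1) conv] by metis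
  obtain \<sigma> where \<sigma>: "\<And>f. \<sigma> (rat_eval f \<beta>) = rat_eval f \<gamma>"
    using alg_conjugates_hom[OF \<gamma>] by metis
  \<comment> \<open>The transducer has the windows over \<open>B\<close> as states and \<sigma> of
    the weight as carry; the digits it reads are restricted to \<open>A\<close>, so that its output
    can be fed back.\<close>
  define S where "S = {ys \<in> lists B. length ys = r}"
  define push where "push x ys = butlast (x # ys)" for x and ys :: "complex list"
  have push: "push x ys \<in> S" if "x \<in> B" "ys \<in> S" for x ys
    using that by (auto simp: S_def push_def dest: in_set_butlastD)
  have "finite S"
    using finite_lists_length_eq[OF \<open>finite B\<close>, of r] by (simp add: S_def lists_eq_set)
  have \<sigma>_rule: "\<exists>a\<in>A. \<sigma> a = \<sigma> x + \<sigma> (q ys) - \<gamma> * \<sigma> (q (push x ys))"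
    if x: "x \<in> A" and ys: "ys \<in> S" for x ys
  proof -
    have xB: "x \<in> B" using x \<open>A \<subset> B\<close> by blast
    obtain a where a: "a \<in> A" "x + q ys = a + \<beta> * q (push x ys)"
      using rule[OF xB] ys by (auto simp: S_def push_def)
    have "x \<in> int_adjoin \<beta>" "q ys \<in> int_adjoin \<beta>" "q (push x ys) \<in> int_adjoin \<beta>"
      using xB ys push[OF xB ys] \<open>B \<subseteq> int_adjoin \<beta>\<close> q by (auto simp: S_def)
    then obtain f g h where fgh: "x = rat_eval f \<beta>" "q ys = rat_eval g \<beta>" "q (push x ys) = rat_eval h \<beta>"
      using int_adjoin_subset_rat_eval[of \<beta>] by blast
    \<comment> \<open>One polynomial for the whole right-hand side: evaluating it at \<gamma>
      instead of \<beta> transports the rewriting rule.\<close>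
    define p where "p = f + g - [:0, 1:] * h"
    have ev: "rat_eval p u = rat_eval f u + rat_eval g u - u * rat_eval h u" for u
      unfolding p_def map_poly_of_rat_add map_poly_of_rat_diff map_poly_of_rat_mult
      by (simp add: map_poly_pCons)
    have "a = x + q ys - \<beta> * q (push x ys)" using a(2) by (simp add: algebra_simps)
    also have "\<dots> = rat_eval p \<beta>" unfolding ev fgh[symmetric] ..
    finally have "\<sigma> a = rat_eval p \<gamma>" by (simp only: \<sigma>)
    also have "\<dots> = \<sigma> x + \<sigma> (q ys) - \<gamma> * \<sigma> (q (push x ys))"
      unfolding ev using \<sigma>[of f] \<sigma>[of g] \<sigma>[of h] unfolding fgh[symmetric] by simp
    finally show ?thesis using a(1) by blast
  qed
  have q0: "q ys = 0" if ys: "ys \<in> S" for ys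
  proof -
    have "\<sigma> (q ys) = 0"
    proof (rule transducer_carry_zero[where t = "\<lambda>ys. \<sigma> (q ys)" and S = S and step = push
          and d = \<sigma>, OF small \<open>finite A\<close> _ _ _ \<sigma>_rule ys])
      show "A \<noteq> {}" using \<open>0 \<in> A\<close> by blast
      show "finite ((\<lambda>ys. \<sigma> (q ys)) ` S)" using \<open>finite S\<close> by simp
      show "push x ys \<in> S" if "x \<in> A" "ys \<in> S" for x ys
        using push that \<open>A \<subset> B\<close> by blast
    qed
    moreover obtain f where "q ys = rat_eval f \<beta>"
      using q[of ys] ys int_adjoin_subset_rat_eval[of \<beta>] by (auto simp: S_def)
    \<comment> \<open>\<sigma> is injective on the values at \<beta>, since conjugacy is
      symmetric.\<close>
    ultimately show "q ys = 0"
      using \<sigma> alg_conjugates_rat_eval[OF alg_conjugates_sym[OF \<gamma>]] by simp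
  qed
  have S0: "replicate r 0 \<in> S" using \<open>0 \<in> A\<close> \<open>A \<subset> B\<close> by (auto simp: S_def)
  \<comment> \<open>With zero weights before and after, the rule reads \<open>x = a\<close>; here
    \<open>x\<close> ranges over all of \<open>B\<close>, not only \<open>A\<close>.\<close>
  have "x \<in> A" if "x \<in> B" for x
    using rule[OF that, of "replicate r 0"] S0 q0[OF S0] q0[OF push[OF that S0]]
    by (auto simp: S_def push_def)
  then show False using \<open>A \<subset> B\<close> by blast
qed

theorem theorem10:
  fixes \<beta> :: complex and A B :: "complex set"
  assumes "algebraic_int \<beta>" and "norm \<beta> > 1"
    and "finite A" and "A \<subseteq> int_adjoin \<beta>"
    and "0 \<in> A" and "1 \<in> radix_set A \<beta>"
    and "finite B" and "B \<subseteq> int_adjoin \<beta>"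
    and "A \<subset> B" and "B \<subseteq> A + A"
    and "ewm_converges \<beta> A B"
  shows "expanding \<beta>"
  unfolding expanding_def
proof
  fix \<gamma> assume \<gamma>: "\<gamma> \<in> alg_conjugates \<beta>"
  have "\<beta> \<noteq> 0" using assms(2) by auto
  \<comment> \<open>Stated for all conjugates, because it is applied to
    \<open>inverse \<beta>\<close> as well as to \<gamma>.\<close>
  have ge: "norm y \<ge> 1" if "y \<in> alg_conjugates \<beta>" for y
    using ewm_converges_conjugate_norm_ge_1[OF \<open>\<beta> \<noteq> 0\<close> assms(3,5,7,9,8,11) that] .
  have "norm \<gamma> \<noteq> 1"
  proof
    assume "norm \<gamma> = 1"
    then have "norm (inverse \<beta>) \<ge> 1"
      using ge inverse_in_alg_conjugates[OF \<gamma>] \<open>\<beta> \<noteq> 0\<close> by blast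
    then show False using assms(2) by (simp add: norm_inverse one_le_inverse_iff)
  qed
  with ge[OF \<gamma>] show "norm \<gamma> > 1" by simp
qed

end
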